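(* Let $N\in\mathbb{N}$ and let $z_0=-1$ or $z_0=0$. Assume that a function $F_1:[z_0,1]\to\mathbb{R}$ can be represented as $$F_1(x)=c_1(1-x)^{1/2}+c_2(1-x)^{3/2}+\tilde F_1(x),\quad x\in[z_0,1],$$ where $c_1,c_2\in\mathbb{R}$ and $\tilde F_1\in C^2[z_0,1]$. For integers $n\ge N$ let $$R_n:=\int_{z_0}^1F_1(x)\,dx-\left(\frac{1}{2n}F_1(z_0)+\frac{1}{2n}F_1(1)+\sum_{k=z_0n+1}^{n-1}\frac1n F_1\left(\frac kn\right)\right).$$ Then: 1. There exists $L_1=L_1(F_1,N)>0$ such that $$|R_n|\le L_1\frac{1}{n^{3/2}}\quad\text{for all integers } n\ge N.$$ 2. If, additionally, $\tilde F_1(x)=c_3(1-x)^{5/2}+c_4(1-x)^{7/2}+\bar F_1(x)$ for $x\in[z_0,1]$, where $c_3,c_4\in\mathbb{R}$ and $\bar F_1\in C^4[z_0,1]$, then there exists $\bar L_1=\bar L_1(F_1,N)>0$ such that $$\left|(n+1)^2R_{n+1}-n^2R_n\right|\le\bar L_1\frac{1}{n^{1/2}}\quad\text{for all integers } n\ge N.$$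
   Context: $\mathbb{N}$ denotes the positive integers. $C^m[a,b]$ denotes the $m$ times continuously differentiable real-valued functions on the closed interval $[a,b]$ (one-sided derivatives at the endpoints). An empty sum equals $0$. The notation $L_1(F_1,N)$ means that the constant may depend on $F_1$ and $N$ (and on $z_0$), but not on $n$. *)

theory Defs
  imports "HOL-Analysis.Analysis"
begin

(* The derivative is taken within the interval, hence it is one-sided at the endpoints, and only
   the values of f on the interval matter. For a < b the witness f' is unique on the interval. *)
primrec C_diff_on :: "nat \<Rightarrow> real \<Rightarrow> real \<Rightarrow> (real \<Rightarrow> real) \<Rightarrow> bool" where
  "C_diff_on 0 a b f \<longleftrightarrow> continuous_on {a..b} f"
| "C_diff_on (Suc m) a b f \<longleftrightarrow>
     (\<exists>f'. (\<forall>x\<in>{a..b}. (f has_real_derivative f' x) (at x within {a..b})) \<and> C_diff_on m a b f')"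

(* The left endpoint z is an integer so that z * n is a summation bound. *)
definition trapezoid_error :: "int \<Rightarrow> (real \<Rightarrow> real) \<Rightarrow> nat \<Rightarrow> real" where
  "trapezoid_error z F n =
     integral {of_int z..1} F
     - (1 / (2 * real n) * F (of_int z) + 1 / (2 * real n) * F 1
        + (\<Sum>k = z * int n + 1..int n - 1. 1 / real n * F (of_int k / real n)))"

end

theory Submission
  imports Defs "HOL-Real_Asymp.Real_Asymp"
begin

text \<open>On each cell of length $h = 1/n$ the trapezoid rule has an error of order $h^3$ if the integrand is
  twice continuously differentiable, and after adding the correction $h^2 (f'(b) - f'(a)) / 12$ an
  error of order $h^4$ if it is three times continuously differentiable. Summing over the cells, of
  which there are a constant times $n$, gives $R_n = O(n^{-2})$ in the first case
  (\<open>trapezoid_error_C2\<close>). In the second case the corrections telescope and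
  $R_n = c / n^2 + O(n^{-3})$ (\<open>corrected_trapezoid_error_C3\<close>), so that $n^2 R_n$ is a constant
  up to $O(n^{-1})$ and its increments are $O(n^{-1})$. The smooth parts of the integrand therefore
  satisfy better bounds than the ones claimed.

  The rates are dictated by the singular terms $(1 - x)^s$ with $s \<ge> 1/2$. These are homogeneous in
  the distance to the endpoint, so the substitution $t = n (1 - x)$ gives
  $R_n = n^{-s-1} E_n$, where $E_n$ is the sum of the trapezoid errors of $t^s$ over the cells
  $[j, j + 1]$ with $j < \<kappa> n$ and $\<kappa> = 1 - z_0$ (\<open>trapezoid_error_endpoint_power\<close>). The $j$-th of
  these errors is at most of order $(j + 1)^{s - 2}$, by the cell bound for $j \<ge> 1$ and trivially for $j = 0$. Hence
  $E_n = O(n^{s - 1/2})$ and $E_{n+1} - E_n = O(n^{s - 2})$. The first estimate gives $R_n = O(n^{-3/2})$,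
  and both together give that $n^{1 - s} E_n$ has increments of order $n^{-1/2}$
  (\<open>weighted_increment_endpoint_power\<close>). Both quantities are linear in the integrand, so adding up
  the terms of the representation of $F$ proves the theorem.\<close>

section \<open>The composite rule as a sum over cells\<close>

text \<open>The sign is kept and both nodes carry half a weight, so that the values at nodes shared by adjacent
  cells combine and the defects add up to the error of the composite rule.\<close>
definition trapezoid_defect :: "(real \<Rightarrow> real) \<Rightarrow> real \<Rightarrow> real \<Rightarrow> real" where
  "trapezoid_defect f a b = integral {a..b} f - (b - a) / 2 * (f a + f b)"

text \<open>Cells are counted from the right endpoint $1$: the singularity sits there, and in the variable
  $n (1 - x)$ the $j$-th cell becomes $[j, j + 1]$, whatever $n$ is.\<close>
lemma trapezoid_error_eq_sum_defects:
  fixes z :: int and m n :: nat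
  assumes "z < 1" and "continuous_on {of_int z..1} f" and "0 < n" and m: "int m = (1 - z) * int n"
  shows "trapezoid_error z f n
    = (\<Sum>j<m. trapezoid_defect f (1 - real (Suc j) / real n) (1 - real j / real n))"
proof -
  \<comment> \<open>The induction starts with no cell. The left node has weight $1/(2n)$ but lies in the range of
    the sum, hence the minus sign of its half.\<close>
  have partial: "i \<le> m \<Longrightarrow>
    (\<Sum>j<i. trapezoid_defect f (1 - real (Suc j) / real n) (1 - real j / real n))
    = integral {1 - real i / real n..1} f
      - (f 1 / (2 * real n) - f (1 - real i / real n) / (2 * real n)
        + (\<Sum>k = int n - int i..int n - 1. f (of_int k / real n) / real n))" for i
  proof (induction i)
    case (Suc i)
    have "real (Suc i) \<le> real m" using Suc.prems by simp
    also have mr: "real m = (1 - of_int z) * real n"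
      using arg_cong[OF m, of "of_int :: int \<Rightarrow> real"] by simp
    finally have left: "of_int z \<le> 1 - real (Suc i) / real n"
      using \<open>0 < n\<close> by (simp add: field_simps)
    have "f integrable_on {1 - real (Suc i) / real n..1}"
      using left by (intro integrable_continuous_real continuous_on_subset[OF assms(2)]) auto
    moreover have "1 - real (Suc i) / real n \<le> 1 - real i / real n"
      using \<open>0 < n\<close> by (simp add: field_simps)
    ultimately have int: "integral {1 - real (Suc i) / real n..1} f
        = integral {1 - real (Suc i) / real n..1 - real i / real n} f
          + integral {1 - real i / real n..1} f"
      by (intro Henstock_Kurzweil_Integration.integral_combine [symmetric]) auto
    have "{int n - int (Suc i)..int n - 1} = insert (int n - int (Suc i)) {int n - int i..int n - 1}"
      by auto
    hence sum: "(\<Sum>k = int n - int (Suc i)..int n - 1. f (of_int k / real n) / real n)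
        = f (1 - real (Suc i) / real n) / real n
          + (\<Sum>k = int n - int i..int n - 1. f (of_int k / real n) / real n)"
      using \<open>0 < n\<close> by (simp add: diff_divide_distrib add_divide_distrib)
    have width: "1 - real i / real n - (1 - real (Suc i) / real n) = 1 / real n"
      by (simp add: add_divide_distrib)
    have IH: "(\<Sum>j<i. trapezoid_defect f (1 - real (Suc j) / real n) (1 - real j / real n))
      = integral {1 - real i / real n..1} f
        - (f 1 / (2 * real n) - f (1 - real i / real n) / (2 * real n)
          + (\<Sum>k = int n - int i..int n - 1. f (of_int k / real n) / real n))"
      using Suc by simp
    have half: "1 / real n / 2 * (u + v) = v / real n - (v / (2 * real n) - u / (2 * real n))"
      for u v using \<open>0 < n\<close> by (simp add: field_simps)
    have top: "trapezoid_defect f (1 - real (Suc i) / real n) (1 - real i / real n)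
        = integral {1 - real (Suc i) / real n..1 - real i / real n} f
          - (f (1 - real i / real n) / real n - (f (1 - real i / real n) / (2 * real n)
              - f (1 - real (Suc i) / real n) / (2 * real n)))"
      unfolding trapezoid_defect_def width half ..
    show ?case
      unfolding sum.lessThan_Suc IH int sum top by simp
  qed simp
  have left: "1 - real m / real n = of_int z"
    using arg_cong[OF m, of "of_int :: int \<Rightarrow> real"] \<open>0 < n\<close> by (simp add: field_simps)
  show ?thesis
  proof -
    have "z * int n < 1 * int n" using \<open>z < 1\<close> \<open>0 < n\<close> by (intro mult_strict_right_mono) auto
    hence "{int n - int m..int n - 1} = insert (z * int n) {z * int n + 1..int n - 1}"
      using m by (auto simp: algebra_simps)
    hence "(\<Sum>k = int n - int m..int n - 1. f (of_int k / real n) / real n)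
        = f (of_int z) / real n + (\<Sum>k = z * int n + 1..int n - 1. f (of_int k / real n) / real n)"
      using \<open>0 < n\<close> by simp
    with partial[of m] show ?thesis
      by (simp add: trapezoid_error_def left field_simps)
  qed
qed

lemma cell_subset:
  fixes z :: int
  assumes "0 < n" "int m = (1 - z) * int n" "j < m"
  shows "{1 - real (Suc j) / real n..1 - real j / real n} \<subseteq> {of_int z..1}"
proof -
  have "real (Suc j) \<le> real m" using assms(3) by simp
  also have "real m = (1 - of_int z) * real n"
    using arg_cong[OF assms(2), of "of_int :: int \<Rightarrow> real"] by simp
  finally have "real (Suc j) / real n \<le> 1 - of_int z"
    using assms(1) by (simp add: pos_divide_le_eq)
  moreover have "0 \<le> real j / real n" by simp
  ultimately show ?thesis by (auto simp del: of_nat_Suc)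
qed

lemma cell_width: "1 - real j / real n - (1 - real (Suc j) / real n) = 1 / real n"
  by (simp add: add_divide_distrib)

lemma trapezoid_error_cong:
  assumes "\<And>x. x \<in> {of_int z..1} \<Longrightarrow> f x = g x" and "z \<le> 1"
  shows "trapezoid_error z f n = trapezoid_error z g n"
proof -
  have "f (of_int k / real n) = g (of_int k / real n)" if "k \<in> {z * int n + 1..int n - 1}" for k
  proof (cases "n = 0")
    case False
    have "real_of_int (z * int n) \<le> of_int k" "real_of_int k \<le> of_int (int n)"
      using that by (simp_all only: of_int_le_iff atLeastAtMost_iff, linarith+)
    thus ?thesis using False
      by (intro assms(1)) (simp add: pos_le_divide_eq pos_divide_le_eq)
  qed (use that in simp)
  moreover have "integral {of_int z..1} f = integral {of_int z..1} g"
    using assms(1) by (rule Henstock_Kurzweil_Integration.integral_cong)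
  ultimately show ?thesis
    using assms by (simp add: trapezoid_error_def)
qed

lemma trapezoid_error_add:
  assumes "continuous_on {of_int z..1} f" "continuous_on {of_int z..1} g"
  shows "trapezoid_error z (\<lambda>x. f x + g x) n = trapezoid_error z f n + trapezoid_error z g n"
proof -
  have "integral {of_int z..1} (\<lambda>x. f x + g x)
      = integral {of_int z..1} f + integral {of_int z..1} g"
    using assms by (intro Henstock_Kurzweil_Integration.integral_add integrable_continuous_real)
  thus ?thesis
    by (simp add: trapezoid_error_def sum.distrib distrib_left)
qed

lemma trapezoid_error_cmult:
  "trapezoid_error z (\<lambda>x. c * f x) n = c * trapezoid_error z f n"
  by (simp add: trapezoid_error_def sum_distrib_left algebra_simps)

text \<open>The weight $n^2$ turns the leading error term $c / n^2$ of a smooth integrand into a constant, which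
  the increment removes.\<close>
definition weighted_increment :: "int \<Rightarrow> (real \<Rightarrow> real) \<Rightarrow> nat \<Rightarrow> real" where
  "weighted_increment z f n
    = (real n + 1)\<^sup>2 * trapezoid_error z f (n + 1) - (real n)\<^sup>2 * trapezoid_error z f n"

lemma weighted_increment_add:
  assumes "continuous_on {of_int z..1} f" "continuous_on {of_int z..1} g"
  shows "weighted_increment z (\<lambda>x. f x + g x) n = weighted_increment z f n + weighted_increment z g n"
  by (simp add: weighted_increment_def trapezoid_error_add[OF assms] algebra_simps)

lemma weighted_increment_cmult:
  "weighted_increment z (\<lambda>x. c * f x) n = c * weighted_increment z f n"
  by (simp add: weighted_increment_def trapezoid_error_cmult algebra_simps)

section \<open>Local error of the trapezoid rule\<close>

text \<open>The defect vanishes on a degenerate interval, so bounds for it come from integrating a bound for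
  its derivative with respect to the right end. That derivative is half a Taylor remainder of $f$
  expanded at $t$ and evaluated at $a$.\<close>
lemma has_real_derivative_trapezoid_defect:
  fixes f f' :: "real \<Rightarrow> real"
  assumes "\<And>x. x \<in> {a..b} \<Longrightarrow> (f has_real_derivative f' x) (at x within {a..b})"
    and "t \<in> {a..b}"
  shows "(trapezoid_defect f a has_real_derivative (f t - f a - (t - a) * f' t) / 2)
    (at t within {a..b})"
proof -
  have "continuous_on {a..b} f"
    using assms(1) by (meson DERIV_continuous continuous_on_eq_continuous_within)
  from integral_has_real_derivative[OF this assms(2)]
  show ?thesis
    unfolding trapezoid_defect_def [abs_def]
    by (auto intro!: derivative_eq_intros assms simp: field_simps)
qed

text \<open>The optimal constant is $1/12$; the mean value inequality used here loses a constant factor, which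
  is irrelevant for the rates.\<close>
lemma trapezoid_defect_bound:
  fixes f f' f'' :: "real \<Rightarrow> real"
  assumes "a \<le> b"
    and f: "\<And>x. x \<in> {a..b} \<Longrightarrow> (f has_real_derivative f' x) (at x within {a..b})"
    and f': "\<And>x. x \<in> {a..b} \<Longrightarrow> (f' has_real_derivative f'' x) (at x within {a..b})"
    and M: "\<And>x. x \<in> {a..b} \<Longrightarrow> \<bar>f'' x\<bar> \<le> M"
  shows "\<bar>trapezoid_defect f a b\<bar> \<le> M * (b - a) ^ 3"
proof -
  have "0 \<le> M" using M[of a] \<open>a \<le> b\<close> by auto
  have bound: "\<bar>(f t - f a - (t - a) * f' t) / 2\<bar> \<le> M * (b - a)\<^sup>2" if t: "t \<in> {a..b}" for t
  proof -
    \<comment> \<open>The list supplies the sequence of derivatives that Taylor's theorem expects.\<close>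
    have "norm ((\<lambda>i. [f, f', f''] ! i) 0 a - (\<Sum>i\<le>1. (\<lambda>i. [f, f', f''] ! i) i t * (a - t) ^ i / fact i))
        \<le> M * norm (a - t) ^ Suc 1 / fact 1"
      using t \<open>a \<le> b\<close> M
      by (intro field_Taylor[of "{a..b}"]) (auto simp: le_Suc_eq f f')
    hence "\<bar>f t - f a - (t - a) * f' t\<bar> \<le> M * (t - a)\<^sup>2"
      by (simp add: power2_eq_square abs_if algebra_simps split: if_splits)
    also have "\<dots> \<le> M * (b - a)\<^sup>2"
      using t \<open>0 \<le> M\<close> by (intro mult_left_mono power_mono) auto
    finally show ?thesis by simp
  qed
  have "norm (trapezoid_defect f a b - trapezoid_defect f a a) \<le> M * (b - a)\<^sup>2 * norm (b - a)"
    using bound \<open>a \<le> b\<close>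
    by (intro field_differentiable_bound[of "{a..b}", OF _ has_real_derivative_trapezoid_defect[OF f]]) auto
  thus ?thesis
    using \<open>a \<le> b\<close> by (simp add: trapezoid_defect_def power3_eq_cube power2_eq_square mult_ac)
qed

text \<open>The first Euler--Maclaurin correction gains one order. Differentiate with respect to the right end
  $t$ and expand at $t$: the plain defect contributes $-(t - a)^2 f''(t) / 4$, and a correction with
  coefficient $c$ contributes $3 c (t - a)^2 f''(t)$. They cancel for $c = 1/12$, which leaves third
  order terms.\<close>
lemma corrected_trapezoid_defect_bound:
  fixes f f' f'' f''' :: "real \<Rightarrow> real"
  assumes "a \<le> b"
    and f: "\<And>x. x \<in> {a..b} \<Longrightarrow> (f has_real_derivative f' x) (at x within {a..b})"
    and f': "\<And>x. x \<in> {a..b} \<Longrightarrow> (f' has_real_derivative f'' x) (at x within {a..b})"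
    and f'': "\<And>x. x \<in> {a..b} \<Longrightarrow> (f'' has_real_derivative f''' x) (at x within {a..b})"
    and M: "\<And>x. x \<in> {a..b} \<Longrightarrow> \<bar>f''' x\<bar> \<le> M"
  shows "\<bar>trapezoid_defect f a b + (b - a)\<^sup>2 / 12 * (f' b - f' a)\<bar> \<le> M * (b - a) ^ 4"
proof -
  \<comment> \<open>\<open>G\<close> is the corrected defect as a function of the right end, \<open>G'\<close> its derivative.\<close>
  define G where "G t = trapezoid_defect f a t + (t - a)\<^sup>2 / 12 * (f' t - f' a)" for t
  define G' where "G' t = (f t - f a - (t - a) * f' t) / 2
      + ((t - a) / 6 * (f' t - f' a) + (t - a)\<^sup>2 / 12 * f'' t)" for t
  have "0 \<le> M" using M[of a] \<open>a \<le> b\<close> by auto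
  have G': "(G has_real_derivative G' t) (at t within {a..b})" if "t \<in> {a..b}" for t
    unfolding G_def [abs_def] G'_def
    by (rule DERIV_add[OF has_real_derivative_trapezoid_defect[OF f that]])
      (auto intro!: derivative_eq_intros f'[OF that] simp: that field_simps)
  have bound: "norm (G' t) \<le> M * (b - a) ^ 3" if t: "t \<in> {a..b}" for t
  proof -
    have sq: "(a - t) * (a - t) = (t - a) * (t - a)" by (simp add: algebra_simps)
    \<comment> \<open>\<open>?p\<close> and \<open>?q\<close> are Taylor remainders at \<open>t\<close>; \<open>G'\<close> is a combination of these alone.\<close>
    let ?p = "f a - (f t + f' t * (a - t) + f'' t * (a - t)\<^sup>2 / 2)"
    let ?q = "f' a - (f' t + f'' t * (a - t))"
    have "norm ((\<lambda>i. [f, f', f'', f'''] ! i) 0 a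
        - (\<Sum>i\<le>2. (\<lambda>i. [f, f', f'', f'''] ! i) i t * (a - t) ^ i / fact i))
        \<le> M * norm (a - t) ^ Suc 2 / fact 2"
      using t \<open>a \<le> b\<close> M
      by (intro field_Taylor[of "{a..b}"]) (auto simp: le_Suc_eq numeral_2_eq_2 f f' f'')
    hence p: "\<bar>?p\<bar> \<le> M * (t - a) ^ 3 / 2"
      using t by (simp add: numeral_2_eq_2 numeral_3_eq_3 sq)
    have "norm ((\<lambda>i. [f', f'', f'''] ! i) 0 a
        - (\<Sum>i\<le>1. (\<lambda>i. [f', f'', f'''] ! i) i t * (a - t) ^ i / fact i))
        \<le> M * norm (a - t) ^ Suc 1 / fact 1"
      using t \<open>a \<le> b\<close> M
      by (intro field_Taylor[of "{a..b}"]) (auto simp: le_Suc_eq f' f'')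
    hence "\<bar>?q\<bar> \<le> M * (t - a)\<^sup>2"
      using t by (simp add: power2_eq_square sq)
    hence "(t - a) * \<bar>?q\<bar> \<le> (t - a) * (M * (t - a)\<^sup>2)"
      using t by (intro mult_left_mono) auto
    hence q: "\<bar>(t - a) * ?q\<bar> \<le> M * (t - a) ^ 3"
      using t by (simp add: abs_mult power3_eq_cube power2_eq_square mult_ac)
    have "G' t = - ?p / 2 - (t - a) * ?q / 6"
      by (simp add: G'_def field_simps power2_eq_square)
    moreover have "\<bar>- u / 2 - v / 6\<bar> \<le> \<bar>u\<bar> / 2 + \<bar>v\<bar> / 6" for u v :: real by linarith
    ultimately have "norm (G' t) \<le> \<bar>?p\<bar> / 2 + \<bar>(t - a) * ?q\<bar> / 6"
      unfolding real_norm_def by (simp only:)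
    also have "\<dots> \<le> M * (t - a) ^ 3 / 4 + M * (t - a) ^ 3 / 6" using p q by simp
    also have "\<dots> \<le> M * (t - a) ^ 3"
      using t \<open>0 \<le> M\<close> by simp
    also have "\<dots> \<le> M * (b - a) ^ 3"
      using t \<open>0 \<le> M\<close> by (intro mult_left_mono power_mono) auto
    finally show ?thesis .
  qed
  have "norm (G b - G a) \<le> M * (b - a) ^ 3 * norm (b - a)"
    using \<open>a \<le> b\<close> by (intro field_differentiable_bound[of "{a..b}", OF _ G' bound]) auto
  thus ?thesis
    using \<open>a \<le> b\<close> by (simp add: G_def trapezoid_defect_def power_numeral_reduce mult_ac)
qed

section \<open>Smooth integrands\<close>

lemma C_diff_on_imp_continuous_on: "C_diff_on m a b f \<Longrightarrow> continuous_on {a..b} f"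
  by (cases m) (auto simp: continuous_on_eq_continuous_within intro: DERIV_continuous)

lemma C_diff_on_Suc_imp: "C_diff_on (Suc m) a b f \<Longrightarrow> C_diff_on m a b f"
proof (induction m arbitrary: f)
  case 0
  from C_diff_on_imp_continuous_on[OF this] show ?case by simp
next
  case (Suc m)
  then obtain f' where "\<forall>x\<in>{a..b}. (f has_real_derivative f' x) (at x within {a..b})"
      and "C_diff_on (Suc m) a b f'"
    unfolding C_diff_on.simps(2)[of "Suc m"] by blast
  with Suc.IH show ?case by auto
qed

lemma continuous_on_interval_bounded:
  fixes f :: "real \<Rightarrow> real"
  assumes "continuous_on {a..b} f"
  obtains M where "M \<ge> 0" "\<And>x. x \<in> {a..b} \<Longrightarrow> \<bar>f x\<bar> \<le> M"
proof -
  have "bounded (f ` {a..b})"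
    using assms by (intro compact_imp_bounded compact_continuous_image) auto
  then obtain M where "\<forall>x\<in>{a..b}. \<bar>f x\<bar> \<le> M" by (auto simp: bounded_iff)
  thus thesis by (intro that[of "max 0 M"]) force+
qed

lemma trapezoid_error_C2:
  fixes z :: int
  assumes "z < 1" and "C_diff_on 2 (of_int z) 1 f"
  shows "trapezoid_error z f \<in> O(\<lambda>n. 1 / real n ^ 2)"
proof -
  let ?I = "{of_int z..1::real}"
  obtain f' f'' where f: "\<And>x. x \<in> ?I \<Longrightarrow> (f has_real_derivative f' x) (at x within ?I)"
    and f': "\<And>x. x \<in> ?I \<Longrightarrow> (f' has_real_derivative f'' x) (at x within ?I)"
    and "continuous_on ?I f''"
    using assms(2) unfolding numeral_2_eq_2 C_diff_on.simps by blast
  then obtain M where M: "\<And>x. x \<in> ?I \<Longrightarrow> \<bar>f'' x\<bar> \<le> M"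
    using continuous_on_interval_bounded by metis
  have "\<bar>trapezoid_error z f n\<bar> \<le> (1 - of_int z) * M * (1 / real n ^ 2)" if "0 < n" for n
  proof -
    define m where "m = nat ((1 - z) * int n)"
    have m: "int m = (1 - z) * int n" using \<open>z < 1\<close> by (simp add: m_def)
    have "\<bar>trapezoid_error z f n\<bar>
        \<le> (\<Sum>j<m. \<bar>trapezoid_defect f (1 - real (Suc j) / real n) (1 - real j / real n)\<bar>)"
      unfolding trapezoid_error_eq_sum_defects
          [OF \<open>z < 1\<close> C_diff_on_imp_continuous_on[OF assms(2)] \<open>0 < n\<close> m]
      by (rule sum_abs)
    also have "\<dots> \<le> (\<Sum>j<m. M * (1 / real n) ^ 3)"
    proof (rule sum_mono)
      fix j assume "j \<in> {..<m}"
      hence sub: "{1 - real (Suc j) / real n..1 - real j / real n} \<subseteq> ?I"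
        using cell_subset[OF \<open>0 < n\<close> m] by blast
      show "\<bar>trapezoid_defect f (1 - real (Suc j) / real n) (1 - real j / real n)\<bar>
          \<le> M * (1 / real n) ^ 3"
        unfolding cell_width[of j n, symmetric]
        by (intro trapezoid_defect_bound[where f' = f' and f'' = f''] M[OF subsetD[OF sub]]
            DERIV_subset[OF f[OF subsetD[OF sub]] sub] DERIV_subset[OF f'[OF subsetD[OF sub]] sub])
          (simp_all add: divide_right_mono)
    qed
    also have "\<dots> = real_of_int (int m) * M / real n ^ 3"
      by (simp add: power_divide)
    also have "\<dots> = (1 - of_int z) * M * (1 / real n ^ 2)"
      unfolding m using \<open>0 < n\<close> by (simp add: field_simps power3_eq_cube power2_eq_square)
    finally show ?thesis .
  qed
  thus ?thesis
    by (intro bigoI[where c = "(1 - of_int z) * M"] eventually_mono[OF eventually_gt_at_top[of 0]])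
      auto
qed

text \<open>The corrections of the cells telescope, so the leading term of the error is exactly a multiple of
  $1/n^2$. This is why the weight $n^2$ removes it when consecutive errors are compared.\<close>
lemma corrected_trapezoid_error_C3:
  fixes z :: int
  assumes "z < 1" and "C_diff_on 3 (of_int z) 1 f"
  obtains c where "(\<lambda>n. trapezoid_error z f n - c / real n ^ 2) \<in> O(\<lambda>n. 1 / real n ^ 3)"
proof -
  let ?I = "{of_int z..1::real}"
  obtain f' f'' f''' where f: "\<And>x. x \<in> ?I \<Longrightarrow> (f has_real_derivative f' x) (at x within ?I)"
    and f': "\<And>x. x \<in> ?I \<Longrightarrow> (f' has_real_derivative f'' x) (at x within ?I)"
    and f'': "\<And>x. x \<in> ?I \<Longrightarrow> (f'' has_real_derivative f''' x) (at x within ?I)"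
    and "continuous_on ?I f'''"
    using assms(2) unfolding numeral_3_eq_3 C_diff_on.simps by blast
  then obtain M where M: "\<And>x. x \<in> ?I \<Longrightarrow> \<bar>f''' x\<bar> \<le> M"
    using continuous_on_interval_bounded by metis
  define c where "c = - (f' 1 - f' (of_int z)) / 12"
  have "\<bar>trapezoid_error z f n - c / real n ^ 2\<bar> \<le> (1 - of_int z) * M * (1 / real n ^ 3)"
    if "0 < n" for n
  proof -
    define m where "m = nat ((1 - z) * int n)"
    have m: "int m = (1 - z) * int n" using \<open>z < 1\<close> by (simp add: m_def)
    have "real m = (1 - of_int z) * real n"
      using arg_cong[OF m, of "of_int :: int \<Rightarrow> real"] by simp
    hence left: "1 - real m / real n = of_int z"
      using \<open>0 < n\<close> by (simp add: field_simps)
    have "- (c / real n ^ 2) = (1 / real n)\<^sup>2 / 12 * (f' 1 - f' (of_int z))"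
      using \<open>0 < n\<close> by (simp add: c_def field_simps)
    also have "f' 1 - f' (of_int z)
        = (\<Sum>j<m. f' (1 - real j / real n) - f' (1 - real (Suc j) / real n))"
      by (subst sum_lessThan_telescope') (simp add: left)
    finally have correction: "- (c / real n ^ 2) = (\<Sum>j<m. (1 / real n)\<^sup>2 / 12 *
        (f' (1 - real j / real n) - f' (1 - real (Suc j) / real n)))"
      unfolding sum_distrib_left .
    have corrected: "trapezoid_error z f n - c / real n ^ 2
        = (\<Sum>j<m. trapezoid_defect f (1 - real (Suc j) / real n) (1 - real j / real n)
            + (1 / real n)\<^sup>2 / 12 * (f' (1 - real j / real n) - f' (1 - real (Suc j) / real n)))"
      unfolding trapezoid_error_eq_sum_defects
          [OF \<open>z < 1\<close> C_diff_on_imp_continuous_on[OF assms(2)] \<open>0 < n\<close> m]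
        sum.distrib correction[symmetric]
      by simp
    have "\<bar>trapezoid_error z f n - c / real n ^ 2\<bar> \<le> (\<Sum>j<m. M * (1 / real n) ^ 4)"
      unfolding corrected
    proof (rule order_trans[OF sum_abs sum_mono])
      fix j assume "j \<in> {..<m}"
      hence sub: "{1 - real (Suc j) / real n..1 - real j / real n} \<subseteq> ?I"
        using cell_subset[OF \<open>0 < n\<close> m] by blast
      show "\<bar>trapezoid_defect f (1 - real (Suc j) / real n) (1 - real j / real n)
            + (1 / real n)\<^sup>2 / 12 * (f' (1 - real j / real n) - f' (1 - real (Suc j) / real n))\<bar>
          \<le> M * (1 / real n) ^ 4"
        unfolding cell_width[of j n, symmetric]
        by (intro corrected_trapezoid_defect_bound[where f'' = f'' and f''' = f''']
            M[OF subsetD[OF sub]] DERIV_subset[OF f[OF subsetD[OF sub]] sub]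
            DERIV_subset[OF f'[OF subsetD[OF sub]] sub]
            DERIV_subset[OF f''[OF subsetD[OF sub]] sub])
          (simp_all add: divide_right_mono)
    qed
    also have "\<dots> = real_of_int (int m) * M / real n ^ 4"
      by (simp add: power_divide)
    also have "\<dots> = (1 - of_int z) * M * (1 / real n ^ 3)"
      unfolding m using \<open>0 < n\<close> by (simp add: field_simps eval_nat_numeral)
    finally show ?thesis .
  qed
  hence "(\<lambda>n. trapezoid_error z f n - c / real n ^ 2) \<in> O(\<lambda>n. 1 / real n ^ 3)"
    by (intro bigoI[where c = "(1 - of_int z) * M"] eventually_mono[OF eventually_gt_at_top[of 0]])
      auto
  thus thesis by (rule that)
qed

text \<open>The constant leading term of $n^2 R_n$ cancels in the increment; what remains is bounded by
  the remainders themselves, $n^2 \cdot O(n^{-3})$.\<close>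
lemma weighted_increment_C3:
  fixes z :: int
  assumes "z < 1" and "C_diff_on 3 (of_int z) 1 f"
  shows "weighted_increment z f \<in> O(\<lambda>n. 1 / real n)"
proof -
  obtain c where c: "(\<lambda>n. trapezoid_error z f n - c / real n ^ 2) \<in> O(\<lambda>n. 1 / real n ^ 3)"
    using corrected_trapezoid_error_C3[OF assms] .
  let ?d = "\<lambda>n. trapezoid_error z f n - c / real n ^ 2"
  have shift: "(\<lambda>n. ?d (n + 1)) \<in> O(\<lambda>n. 1 / real (n + 1) ^ 3)"
    by (rule landau_o.big.compose[OF c]) real_asymp
  have A: "(\<lambda>n. (real n)\<^sup>2 * ?d n) \<in> O(\<lambda>n. (real n)\<^sup>2 * (1 / real n ^ 3))"
    by (intro landau_o.big.mult c) simp
  also have "(\<lambda>n. (real n)\<^sup>2 * (1 / real n ^ 3)) \<in> O(\<lambda>n. 1 / real n)" by real_asymp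
  finally have A: "(\<lambda>n. (real n)\<^sup>2 * ?d n) \<in> O(\<lambda>n. 1 / real n)" .
  have "(\<lambda>n. (real n + 1)\<^sup>2 * ?d (n + 1)) \<in> O(\<lambda>n. (real n + 1)\<^sup>2 * (1 / real (n + 1) ^ 3))"
    by (intro landau_o.big.mult shift) simp
  also have "(\<lambda>n. (real n + 1)\<^sup>2 * (1 / real (n + 1) ^ 3)) \<in> O(\<lambda>n. 1 / real n)" by real_asymp
  finally have B: "(\<lambda>n. (real n + 1)\<^sup>2 * ?d (n + 1)) \<in> O(\<lambda>n. 1 / real n)" .
  have "eventually (\<lambda>n. weighted_increment z f n
      = (real n + 1)\<^sup>2 * ?d (n + 1) - (real n)\<^sup>2 * ?d n) sequentially"
    using eventually_gt_at_top[of 0]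
    by eventually_elim (simp add: weighted_increment_def field_simps add_eq_0_iff)
  thus ?thesis
    using sum_in_bigo(2)[OF B A] by (subst landau_o.big.in_cong)
qed

section \<open>Powers of the distance to the endpoint\<close>

lemma trapezoid_defect_reflect_scale:
  assumes "c > 0" "a \<le> b" "continuous_on {a..b} f"
  shows "trapezoid_defect (\<lambda>x. f (c * (1 - x))) (1 - b / c) (1 - a / c) = trapezoid_defect f a b / c"
proof -
  have img: "(\<lambda>x. (1 / (-c)) *\<^sub>R x + - ((1 / (-c)) *\<^sub>R c)) ` {a..b} = {1 - b / c..1 - a / c}"
    using assms image_affinity_atLeastAtMost[of "1 / (-c)" "1" a b] by (simp add: field_simps)
  have "(f has_integral integral {a..b} f) (cbox a b)"
    using assms(3) by (simp add: integrable_continuous_real integrable_integral)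
  from has_integral_affinity[OF this, of "-c" c] have
    "((\<lambda>x. f (c * (1 - x))) has_integral (1 / c * integral {a..b} f)) {1 - b / c..1 - a / c}"
    using assms(1) img by (simp add: algebra_simps)
  hence "integral {1 - b / c..1 - a / c} (\<lambda>x. f (c * (1 - x))) = 1 / c * integral {a..b} f"
    by (rule integral_unique)
  thus ?thesis
    using assms by (simp add: trapezoid_defect_def field_simps)
qed

text \<open>The second derivative of $t^s$ on $[j, j + 1]$ is of size $j^{s - 2}$. The cell $[0, 1]$, on
  which that derivative may be unbounded, contributes only a constant. Writing $j + 1$ instead of $j$
  on the right keeps the base positive in this case, too.\<close>
lemma power_defect_bound:
  fixes s :: real
  assumes "s > 0"
  obtains C where "C \<ge> 0"
    and "\<And>j. \<bar>trapezoid_defect (\<lambda>t. t powr s) (real j) (real (Suc j))\<bar> \<le> C * real (Suc j) powr (s - 2)"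
proof -
  let ?e = "\<lambda>j. trapezoid_defect (\<lambda>t. t powr s) (real j) (real (Suc j))"
  define C where "C = \<bar>?e 0\<bar> + 4 * \<bar>s * (s - 1)\<bar>"
  have "\<bar>?e j\<bar> \<le> C * real (Suc j) powr (s - 2)" for j
  proof (cases "j = 0")
    case True
    thus ?thesis by (simp add: C_def)
  next
    case False
    let ?J = "{real j..real (Suc j)}"
    have "\<bar>s * ((s - 1) * t powr (s - 2))\<bar> \<le> C * real (Suc j) powr (s - 2)" if t: "t \<in> ?J" for t
    proof -
      \<comment> \<open>Splitting $t^{s-2} = t^s / t^2$ leaves monotone factors for every \<open>s\<close>, above or below 2.\<close>
      have "0 < t" "real (Suc j) / 2 \<le> t" using t False by auto
      hence "(real (Suc j) / 2)\<^sup>2 \<le> t\<^sup>2" by (intro power_mono) auto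
      moreover have "t powr s \<le> real (Suc j) powr s"
        using t \<open>0 < t\<close> assms by (intro powr_mono2) auto
      ultimately have "t powr s / t\<^sup>2 \<le> real (Suc j) powr s / (real (Suc j) / 2)\<^sup>2"
        by (intro frac_le) auto
      hence "t powr (s - 2) \<le> 4 * real (Suc j) powr (s - 2)"
        using \<open>0 < t\<close> by (simp add: powr_diff power_divide mult.commute del: of_nat_Suc)
      hence "\<bar>s * (s - 1)\<bar> * t powr (s - 2) \<le> \<bar>s * (s - 1)\<bar> * (4 * real (Suc j) powr (s - 2))"
        by (rule mult_left_mono) simp
      also have "\<dots> \<le> C * real (Suc j) powr (s - 2)"
        by (simp add: C_def distrib_right mult_ac)
      finally show ?thesis by (simp add: abs_mult mult_ac)
    qed
    hence "\<bar>?e j\<bar> \<le> C * real (Suc j) powr (s - 2) * (real (Suc j) - real j) ^ 3"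
      using False
      by (intro trapezoid_defect_bound[where f' = "\<lambda>t. s * t powr (s - 1)"
            and f'' = "\<lambda>t. s * ((s - 1) * t powr (s - 2))"])
        (auto intro!: derivative_eq_intros)
    thus ?thesis by simp
  qed
  moreover have "C \<ge> 0" by (simp add: C_def)
  ultimately show thesis using that by blast
qed

definition power_defect_sum :: "real \<Rightarrow> nat \<Rightarrow> real" where
  "power_defect_sum s m = (\<Sum>j<m. trapezoid_defect (\<lambda>t. t powr s) (real j) (real (Suc j)))"

text \<open>Homogeneity: in the variable $n (1 - x)$ the integrand is a power of $n$ times $t^s$, and the nodes are
  the integers. All dependence on $n$ is then in an explicit power and in the number of unit cells.\<close>
lemma trapezoid_error_endpoint_power:
  fixes s :: real and \<kappa> n :: nat
  assumes "s > 0" "0 < \<kappa>" "0 < n"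
  shows "trapezoid_error (1 - int \<kappa>) (\<lambda>x. (1 - x) powr s) n
    = real n powr (- s - 1) * power_defect_sum s (\<kappa> * n)"
proof -
  have scale: "(1 - x) powr s = real n powr (- s) * (real n * (1 - x)) powr s" for x
    using \<open>0 < n\<close> by (simp add: powr_mult powr_minus)
  have "trapezoid_error (1 - int \<kappa>) (\<lambda>x. (1 - x) powr s) n
      = real n powr (- s) * trapezoid_error (1 - int \<kappa>) (\<lambda>x. (real n * (1 - x)) powr s) n"
    unfolding scale by (rule trapezoid_error_cmult)
  also have "trapezoid_error (1 - int \<kappa>) (\<lambda>x. (real n * (1 - x)) powr s) n
      = (\<Sum>j<\<kappa> * n. trapezoid_defect (\<lambda>x. (real n * (1 - x)) powr s)
          (1 - real (Suc j) / real n) (1 - real j / real n))"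
    using assms
    by (intro trapezoid_error_eq_sum_defects continuous_on_powr' continuous_intros) auto
  also have "\<dots> = power_defect_sum s (\<kappa> * n) / real n"
    unfolding power_defect_sum_def sum_divide_distrib
    using assms
    by (intro sum.cong refl trapezoid_defect_reflect_scale[where f = "\<lambda>t. t powr s"]
        continuous_on_powr' continuous_intros) auto
  finally show ?thesis
    using \<open>0 < n\<close> by (simp add: powr_diff)
qed

text \<open>For $s = 1/2$ the defects are summable. For larger $s$ the same estimate suffices after splitting
  $j^{s - 2} = j^{s - 1/2} \cdot j^{-3/2}$ and bounding the first factor by its largest value, which
  treats all exponents at once. The result is not sharp for $s > 1/2$, but the resulting rates agree
  with those of the worst case $s = 1/2$.\<close>
lemma power_defect_sum_bigo:
  fixes s :: real and \<kappa> :: nat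
  assumes "s \<ge> 1 / 2"
  shows "(\<lambda>n. power_defect_sum s (\<kappa> * n)) \<in> O(\<lambda>n. real n powr (s - 1 / 2))"
proof -
  obtain C where "C \<ge> 0" and C: "\<And>j. \<bar>trapezoid_defect (\<lambda>t. t powr s) (real j) (real (Suc j))\<bar>
      \<le> C * real (Suc j) powr (s - 2)"
    using power_defect_bound[of s] assms by auto
  have "summable (\<lambda>j. real j powr (- 3 / 2))"
    by (subst summable_real_powr_iff) simp
  hence summable: "summable (\<lambda>j. real (Suc j) powr (- 3 / 2))"
    by (subst summable_Suc_iff)
  define Z where "Z = (\<Sum>j. real (Suc j) powr (- 3 / 2))"
  have "\<bar>power_defect_sum s (\<kappa> * n)\<bar> \<le> C * real \<kappa> powr (s - 1 / 2) * Z * real n powr (s - 1 / 2)" for n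
  proof -
    have "\<bar>power_defect_sum s (\<kappa> * n)\<bar>
        \<le> (\<Sum>j<\<kappa> * n. C * (real (\<kappa> * n) powr (s - 1 / 2) * real (Suc j) powr (- 3 / 2)))"
      unfolding power_defect_sum_def
    proof (rule order_trans[OF sum_abs sum_mono])
      fix j assume "j \<in> {..<\<kappa> * n}"
      hence "real (Suc j) \<le> real (\<kappa> * n)" by (simp only: of_nat_le_iff lessThan_iff Suc_le_eq)
      hence "real (Suc j) powr (s - 1 / 2) \<le> real (\<kappa> * n) powr (s - 1 / 2)"
        using assms by (intro powr_mono2) auto
      hence "real (Suc j) powr (s - 1 / 2) * real (Suc j) powr (- 3 / 2)
          \<le> real (\<kappa> * n) powr (s - 1 / 2) * real (Suc j) powr (- 3 / 2)"
        by (rule mult_right_mono) simp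
      hence "real (Suc j) powr (s - 2)
          \<le> real (\<kappa> * n) powr (s - 1 / 2) * real (Suc j) powr (- 3 / 2)"
        by (simp flip: powr_add)
      thus "\<bar>trapezoid_defect (\<lambda>t. t powr s) (real j) (real (Suc j))\<bar>
          \<le> C * (real (\<kappa> * n) powr (s - 1 / 2) * real (Suc j) powr (- 3 / 2))"
        using C[of j] \<open>C \<ge> 0\<close> by (meson mult_left_mono order_trans)
    qed
    also have "\<dots> = C * real (\<kappa> * n) powr (s - 1 / 2) * (\<Sum>j<\<kappa> * n. real (Suc j) powr (- 3 / 2))"
      by (simp add: sum_distrib_left mult_ac)
    also have "\<dots> \<le> C * real (\<kappa> * n) powr (s - 1 / 2) * Z"
      unfolding Z_def using \<open>C \<ge> 0\<close>
      by (intro mult_left_mono sum_le_suminf summable) auto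
    finally show ?thesis by (simp add: powr_mult mult_ac)
  qed
  thus ?thesis by (intro bigoI[where c = "C * real \<kappa> powr (s - 1 / 2) * Z"]) simp
qed

text \<open>Passing from $n$ to $n + 1$ adds $\<kappa>$ cells, all with index comparable to $n$, so each new defect
  is of size $n^{s - 2}$.\<close>
lemma power_defect_sum_increment_bigo:
  fixes s :: real and \<kappa> :: nat
  assumes "s > 0"
  shows "(\<lambda>n. power_defect_sum s (\<kappa> * (n + 1)) - power_defect_sum s (\<kappa> * n))
    \<in> O(\<lambda>n. real n powr (s - 2))"
proof -
  obtain C where "C \<ge> 0" and C: "\<And>j. \<bar>trapezoid_defect (\<lambda>t. t powr s) (real j) (real (Suc j))\<bar>
      \<le> C * real (Suc j) powr (s - 2)"
    using power_defect_bound[of s] assms by auto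
  have "\<bar>power_defect_sum s (\<kappa> * (n + 1)) - power_defect_sum s (\<kappa> * n)\<bar>
      \<le> real \<kappa> * (C * (2 * real \<kappa>) powr s) * real n powr (s - 2)" if "0 < n" for n
  proof -
    have diff: "power_defect_sum s (\<kappa> * (n + 1)) - power_defect_sum s (\<kappa> * n)
        = (\<Sum>j\<in>{\<kappa> * n..<\<kappa> * (n + 1)}. trapezoid_defect (\<lambda>t. t powr s) (real j) (real (Suc j)))"
      unfolding power_defect_sum_def lessThan_atLeast0
      by (rule sum_diff_nat_ivl) auto
    have "\<bar>power_defect_sum s (\<kappa> * (n + 1)) - power_defect_sum s (\<kappa> * n)\<bar>
        \<le> (\<Sum>j\<in>{\<kappa> * n..<\<kappa> * (n + 1)}. C * ((2 * real \<kappa>) powr s * real n powr (s - 2)))"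
      unfolding diff
    proof (rule order_trans[OF sum_abs sum_mono])
      fix j assume j: "j \<in> {\<kappa> * n..<\<kappa> * (n + 1)}"
      hence "\<kappa> > 0" by (cases \<kappa>) auto
      have "n \<le> \<kappa> * n" using \<open>\<kappa> > 0\<close> by simp
      moreover have "\<kappa> * n \<le> j" using j by simp
      ultimately have "n \<le> Suc j" by linarith
      moreover have "Suc j \<le> 2 * \<kappa> * n"
      proof -
        have "j < \<kappa> * n + \<kappa>" using j by (simp add: algebra_simps)
        moreover have "\<kappa> \<le> \<kappa> * n" using \<open>0 < n\<close> by simp
        moreover have "2 * \<kappa> * n = \<kappa> * n + \<kappa> * n" by simp
        ultimately show ?thesis by linarith
      qed
      ultimately have "real n \<le> real (Suc j)" "real (Suc j) \<le> real (2 * \<kappa> * n)"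
        by (simp_all only: of_nat_le_iff)
      hence lo: "real n \<le> real (Suc j)" and hi: "real (Suc j) \<le> 2 * real \<kappa> * real n"
        by simp_all
      have "real (Suc j) powr s / (real (Suc j))\<^sup>2 \<le> (2 * real \<kappa> * real n) powr s / (real n)\<^sup>2"
        using lo hi \<open>0 < n\<close> assms by (intro frac_le powr_mono2 power_mono) auto
      hence "real (Suc j) powr (s - 2) \<le> (2 * real \<kappa>) powr s * real n powr (s - 2)"
        using \<open>0 < n\<close> by (simp add: powr_diff powr_mult del: of_nat_Suc)
      thus "\<bar>trapezoid_defect (\<lambda>t. t powr s) (real j) (real (Suc j))\<bar>
          \<le> C * ((2 * real \<kappa>) powr s * real n powr (s - 2))"
        using C[of j] \<open>C \<ge> 0\<close> by (meson mult_left_mono order_trans)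
    qed
    also have "\<dots> = real \<kappa> * (C * (2 * real \<kappa>) powr s) * real n powr (s - 2)"
      by simp
    finally show ?thesis .
  qed
  thus ?thesis
    by (intro bigoI[where c = "real \<kappa> * (C * (2 * real \<kappa>) powr s)"]
        eventually_mono[OF eventually_gt_at_top[of 0]]) auto
qed

lemma trapezoid_error_endpoint_power_bigo:
  fixes z :: int and s :: real
  assumes "z < 1" "s \<ge> 1 / 2"
  shows "trapezoid_error z (\<lambda>x. (1 - x) powr s) \<in> O(\<lambda>n. real n powr (- 3 / 2))"
proof -
  define \<kappa> where "\<kappa> = nat (1 - z)"
  have z: "z = 1 - int \<kappa>" "0 < \<kappa>" using assms by (simp_all add: \<kappa>_def)
  have "(\<lambda>n. real n powr (- s - 1) * power_defect_sum s (\<kappa> * n))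
      \<in> O(\<lambda>n. real n powr (- s - 1) * real n powr (s - 1 / 2))"
    by (intro landau_o.big.mult power_defect_sum_bigo assms) simp
  also have "(\<lambda>n. real n powr (- s - 1) * real n powr (s - 1 / 2)) = (\<lambda>n. real n powr (- 3 / 2))"
    by (simp flip: powr_add)
  finally show ?thesis
    using assms
    by (subst landau_o.big.in_cong[OF eventually_mono[OF eventually_gt_at_top[of 0]]])
      (auto simp: z trapezoid_error_endpoint_power)
qed

text \<open>By homogeneity, $n^2 R_n = n^{1 - s} E_n$, with $E_n$ the sum of the defects of $t^s$ over the
  $\<kappa> n$ unit cells. The discrete product rule leaves
  two terms: the increment of $n^{1 - s}$ is of order $n^{-s}$ and $E_n$ of order $n^{s - 1/2}$,
  which gives $n^{-1/2}$; the increment of $E_n$ is of order $n^{s - 2}$, which gives $n^{-1}$.\<close>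
lemma weighted_increment_endpoint_power:
  fixes z :: int and s :: real
  assumes "z < 1" "s \<ge> 1 / 2"
  shows "weighted_increment z (\<lambda>x. (1 - x) powr s) \<in> O(\<lambda>n. real n powr (- 1 / 2))"
proof -
  define \<kappa> where "\<kappa> = nat (1 - z)"
  have z: "z = 1 - int \<kappa>" "0 < \<kappa>" using assms by (simp_all add: \<kappa>_def)
  let ?E = "\<lambda>n. power_defect_sum s (\<kappa> * n)"
  have "(\<lambda>n. (real n + 1) powr (1 - s) - real n powr (1 - s)) \<in> O(\<lambda>n. real n powr (1 - s - 1))"
    by real_asymp
  hence "(\<lambda>n. ((real n + 1) powr (1 - s) - real n powr (1 - s)) * ?E n)
      \<in> O(\<lambda>n. real n powr (1 - s - 1) * real n powr (s - 1 / 2))"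
    by (intro landau_o.big.mult power_defect_sum_bigo assms)
  also have "(\<lambda>n. real n powr (1 - s - 1) * real n powr (s - 1 / 2)) = (\<lambda>n. real n powr (- 1 / 2))"
    by (simp flip: powr_add)
  finally have A: "(\<lambda>n. ((real n + 1) powr (1 - s) - real n powr (1 - s)) * ?E n)
      \<in> O(\<lambda>n. real n powr (- 1 / 2))" .
  have "(\<lambda>n. (real n + 1) powr (1 - s)) \<in> O(\<lambda>n. real n powr (1 - s))"
    by real_asymp
  hence "(\<lambda>n. (real n + 1) powr (1 - s) * (?E (n + 1) - ?E n))
      \<in> O(\<lambda>n. real n powr (1 - s) * real n powr (s - 2))"
    using assms by (intro landau_o.big.mult power_defect_sum_increment_bigo) auto
  also have "(\<lambda>n. real n powr (1 - s) * real n powr (s - 2)) \<in> O(\<lambda>n. real n powr (- 1 / 2))"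
    by (simp flip: powr_add) real_asymp
  finally have B: "(\<lambda>n. (real n + 1) powr (1 - s) * (?E (n + 1) - ?E n))
      \<in> O(\<lambda>n. real n powr (- 1 / 2))" .
  have square: "(real n)\<^sup>2 * real n powr (- s - 1) = real n powr (1 - s)" if "0 < n" for n
  proof -
    have "(real n)\<^sup>2 = real n powr 2" using that by simp
    thus ?thesis by (simp only: powr_add[symmetric]) simp
  qed
  have "weighted_increment z (\<lambda>x. (1 - x) powr s) n
      = ((real n + 1) powr (1 - s) - real n powr (1 - s)) * ?E n
        + (real n + 1) powr (1 - s) * (?E (n + 1) - ?E n)" if "0 < n" for n
  proof -
    have "weighted_increment z (\<lambda>x. (1 - x) powr s) n
        = (real (n + 1))\<^sup>2 * real (n + 1) powr (- s - 1) * ?E (n + 1)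
          - (real n)\<^sup>2 * real n powr (- s - 1) * ?E n"
      using assms that
      by (simp add: weighted_increment_def z trapezoid_error_endpoint_power
          del: of_nat_add of_nat_Suc add: of_nat_add[of n 1, symmetric])
    also have "\<dots> = real (n + 1) powr (1 - s) * ?E (n + 1) - real n powr (1 - s) * ?E n"
      using that by (simp only: square zero_less_Suc add_gr_0 zero_less_one simp_thms)
    finally show ?thesis by (simp add: algebra_simps)
  qed
  thus ?thesis
    using sum_in_bigo(1)[OF A B]
    by (subst landau_o.big.in_cong[OF eventually_mono[OF eventually_gt_at_top[of 0]]]) auto
qed

section \<open>Error rates for a singular integrand\<close>

text \<open>An asymptotic bound holds from some index on; positivity of $g$ lets a larger constant absorb the
  finitely many earlier indices.\<close>
lemma bigo_imp_uniform_bound: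
  fixes f g :: "nat \<Rightarrow> real"
  assumes "f \<in> O(g)" and pos: "\<And>n. n \<ge> N \<Longrightarrow> g n > 0"
  shows "\<exists>L>0. \<forall>n\<ge>N. \<bar>f n\<bar> \<le> L * g n"
proof -
  obtain c where "c > 0" and "eventually (\<lambda>n. norm (f n) \<le> c * norm (g n)) sequentially"
    using assms(1) by (elim landau_o.bigE)
  then obtain n0 where n0: "\<And>n. n \<ge> n0 \<Longrightarrow> \<bar>f n\<bar> \<le> c * \<bar>g n\<bar>"
    by (auto simp: eventually_sequentially)
  define L where "L = c + (\<Sum>n\<in>{N..<n0}. \<bar>f n\<bar> / g n)"
  have nonneg: "0 \<le> (\<Sum>n\<in>{N..<n0}. \<bar>f n\<bar> / g n)"
    using pos by (intro sum_nonneg) (simp add: less_imp_le)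
  have "\<bar>f n\<bar> \<le> L * g n" if "n \<ge> N" for n
  proof (cases "n < n0")
    case True
    have "\<bar>f n\<bar> / g n \<le> (\<Sum>n\<in>{N..<n0}. \<bar>f n\<bar> / g n)"
      using True that pos by (intro member_le_sum) (auto simp: less_imp_le)
    hence "\<bar>f n\<bar> / g n \<le> L" using \<open>c > 0\<close> by (simp add: L_def)
    thus ?thesis using pos[OF that] by (simp add: pos_divide_le_eq)
  next
    case False
    hence "\<bar>f n\<bar> \<le> c * g n" using n0[of n] pos[OF that] by simp
    also have "\<dots> \<le> L * g n"
      using nonneg pos[OF that] by (intro mult_right_mono) (auto simp: L_def)
    finally show ?thesis .
  qed
  moreover have "L > 0" using nonneg \<open>c > 0\<close> by (simp add: L_def)
  ultimately show ?thesis by blast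
qed

theorem proposition1:
  fixes N :: nat and z0 :: int and F Ft :: "real \<Rightarrow> real" and c1 c2 :: real
  assumes "N \<ge> 1"
    and "z0 = -1 \<or> z0 = 0"
    and "\<forall>x\<in>{of_int z0..1}.
           F x = c1 * (1 - x) powr (1/2) + c2 * (1 - x) powr (3/2) + Ft x"
    and "C_diff_on 2 (of_int z0) 1 Ft"
  shows "(\<exists>L>0. \<forall>n\<ge>N. \<bar>trapezoid_error z0 F n\<bar> \<le> L * (1 / real n powr (3/2)))
    \<and> (\<forall>c3 c4 Fb.
         (\<forall>x\<in>{of_int z0..1}.
            Ft x = c3 * (1 - x) powr (5/2) + c4 * (1 - x) powr (7/2) + Fb x)
         \<and> C_diff_on 4 (of_int z0) 1 Fb \<longrightarrow>
         (\<exists>L>0. \<forall>n\<ge>N.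
            \<bar>(real n + 1)\<^sup>2 * trapezoid_error z0 F (n + 1) - (real n)\<^sup>2 * trapezoid_error z0 F n\<bar>
              \<le> L * (1 / real n powr (1/2))))"
proof (intro conjI allI impI)
  have z0: "z0 < 1" "z0 \<le> 1" using assms(2) by auto
  have cont: "continuous_on {of_int z0..1} (\<lambda>x. c * (1 - x) powr s)" if "s > 0" for c s :: real
    using that by (intro continuous_intros continuous_on_powr') auto
  let ?p = "\<lambda>c s x :: real. c * (1 - x) powr s"

  show "\<exists>L>0. \<forall>n\<ge>N. \<bar>trapezoid_error z0 F n\<bar> \<le> L * (1 / real n powr (3/2))"
  proof (rule bigo_imp_uniform_bound)
    note contFt = C_diff_on_imp_continuous_on[OF assms(4)]
    have "trapezoid_error z0 F = trapezoid_error z0 (\<lambda>x. ?p c1 (1/2) x + ?p c2 (3/2) x + Ft x)"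
      using assms(3) z0 by (intro ext trapezoid_error_cong) auto
    also have "\<dots> = (\<lambda>n. c1 * trapezoid_error z0 (\<lambda>x. (1 - x) powr (1/2)) n
        + c2 * trapezoid_error z0 (\<lambda>x. (1 - x) powr (3/2)) n + trapezoid_error z0 Ft n)"
      by (intro ext) (simp add: trapezoid_error_add trapezoid_error_cmult cont contFt continuous_on_add)
    also have "\<dots> \<in> O(\<lambda>n. real n powr (- 3 / 2))"
    proof (intro sum_in_bigo)
      have "trapezoid_error z0 Ft \<in> O(\<lambda>n. 1 / real n ^ 2)"
        using trapezoid_error_C2[OF z0(1) assms(4)] .
      also have "(\<lambda>n. 1 / real n ^ 2) \<in> O(\<lambda>n. real n powr (- 3 / 2))" by real_asymp
      finally show "trapezoid_error z0 Ft \<in> O(\<lambda>n. real n powr (- 3 / 2))" .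
    qed (use trapezoid_error_endpoint_power_bigo[OF z0(1)] in simp_all)
    also have "(\<lambda>n. real n powr (- 3 / 2)) = (\<lambda>n. 1 / real n powr (3/2))"
      by (simp flip: powr_minus_divide)
    finally show "trapezoid_error z0 F \<in> O(\<lambda>n. 1 / real n powr (3/2))" .
  qed (use assms(1) in simp)

  fix c3 c4 :: real and Fb :: "real \<Rightarrow> real"
  assume Fb: "(\<forall>x\<in>{of_int z0..1}.
      Ft x = c3 * (1 - x) powr (5/2) + c4 * (1 - x) powr (7/2) + Fb x) \<and> C_diff_on 4 (of_int z0) 1 Fb"
  have C3: "C_diff_on 3 (of_int z0) 1 Fb"
    using Fb C_diff_on_Suc_imp[of 3] by simp
  show "\<exists>L>0. \<forall>n\<ge>N.
      \<bar>(real n + 1)\<^sup>2 * trapezoid_error z0 F (n + 1) - (real n)\<^sup>2 * trapezoid_error z0 F n\<bar>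
        \<le> L * (1 / real n powr (1/2))"
    unfolding weighted_increment_def[symmetric]
  proof (rule bigo_imp_uniform_bound)
    note contFb = C_diff_on_imp_continuous_on[OF C3]
    have "trapezoid_error z0 F n = trapezoid_error z0
        (\<lambda>x. ?p c1 (1/2) x + ?p c2 (3/2) x + (?p c3 (5/2) x + ?p c4 (7/2) x + Fb x)) n" for n
      using assms(3) z0 Fb by (intro trapezoid_error_cong) auto
    hence "weighted_increment z0 F = weighted_increment z0
        (\<lambda>x. ?p c1 (1/2) x + ?p c2 (3/2) x + (?p c3 (5/2) x + ?p c4 (7/2) x + Fb x))"
      by (intro ext) (simp add: weighted_increment_def)
    also have "\<dots> = (\<lambda>n. c1 * weighted_increment z0 (\<lambda>x. (1 - x) powr (1/2)) n
        + c2 * weighted_increment z0 (\<lambda>x. (1 - x) powr (3/2)) n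
        + (c3 * weighted_increment z0 (\<lambda>x. (1 - x) powr (5/2)) n
          + c4 * weighted_increment z0 (\<lambda>x. (1 - x) powr (7/2)) n + weighted_increment z0 Fb n))"
      by (intro ext) (simp add: weighted_increment_add weighted_increment_cmult cont contFb continuous_on_add)
    also have "\<dots> \<in> O(\<lambda>n. real n powr (- 1 / 2))"
    proof (intro sum_in_bigo)
      have "weighted_increment z0 Fb \<in> O(\<lambda>n. 1 / real n)"
        using weighted_increment_C3[OF z0(1) C3] .
      also have "(\<lambda>n. 1 / real n) \<in> O(\<lambda>n. real n powr (- 1 / 2))" by real_asymp
      finally show "weighted_increment z0 Fb \<in> O(\<lambda>n. real n powr (- 1 / 2))" .
    qed (use weighted_increment_endpoint_power[OF z0(1)] in simp_all)
    also have "(\<lambda>n. real n powr (- 1 / 2)) = (\<lambda>n. 1 / real n powr (1/2))"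
      by (simp flip: powr_minus_divide)
    finally show "weighted_increment z0 F \<in> O(\<lambda>n. 1 / real n powr (1/2))" .
  qed (use assms(1) in simp)
qed

end
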